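(* Let $S$ be a multiplicative subset of a ring $R$ and let $A$, $B$ be $R$-modules such that $A\oplus B$ is a $u$-$S$-pseudo-projective module. Then (1) $A$ is $u$-$S$-projective relative to $B$ and $B$ is $u$-$S$-projective relative to $A$; (2) any $u$-$S$-epimorphism $f:A\to B$ $u$-$S$-splits.
   Context: All rings are commutative with nonzero identity and all modules are unitary. A multiplicative subset $S$ of a ring $R$ is a nonempty subset with $1\in S$, $0\notin S$, and $s_1s_2\in S$ for all $s_1,s_2\in S$. An $R$-module $U$ is $u$-$S$-torsion if $sU=0$ for some $s\in S$. An $R$-homomorphism is a $u$-$S$-monomorphism (resp. $u$-$S$-epimorphism) if its kernel (resp. cokernel) is $u$-$S$-torsion. A sequence $A\xrightarrow{f}B\xrightarrow{g}C$ of $R$-modules is $u$-$S$-exact if there is $s\in S$ with $s\,\mathrm{Ker}(g)\subseteq \mathrm{Im}(f)$ and $s\,\mathrm{Im}(f)\subseteq \mathrm{Ker}(g)$; a sequence $0\to A\to B\to C\to 0$ is $u$-$S$-exact if it is so at each of $A$, $B$, $C$. A $u$-$S$-exact sequence $0\to A\xrightarrow{f}B\xrightarrow{g}C\to 0$ is $u$-$S$-split if there are $s\in S$ and an $R$-homomorphism $f':B\to A$ with $f'f=s1_A$; equivalently, there are $t\in S$ and an $R$-homomorphism $g':C\to B$ with $gg'=t1_C$. A $u$-$S$-epimorphism $f:A\to B$ is said to $u$-$S$-split if the $u$-$S$-exact sequence $0\to \mathrm{Ker}(f)\to A\xrightarrow{f}B\to 0$ is $u$-$S$-split. An $R$-module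 $P$ is $u$-$S$-pseudo-projective if for any submodule $K$ of $P$ there is $s\in S$ such that for any $u$-$S$-epimorphism $f:P\to P/K$, $sf$ can be lifted to an endomorphism of $P$, i.e. there is $g\in \mathrm{End}_R(P)$ with $sf=\eta_K g$, where $\eta_K:P\to P/K$ is the natural map. An $R$-module $M$ is $u$-$S$-projective relative to an $R$-module $N$ if for any $u$-$S$-epimorphism $g:N\to L$ the induced map $\mathrm{Hom}_R(M,g):\mathrm{Hom}_R(M,N)\to \mathrm{Hom}_R(M,L)$ is a $u$-$S$-epimorphism. *)

theory Defs
  imports "HOL-Algebra.Module" "HOL-Algebra.AbelCoset"
begin

section \<open>Modules, homomorphisms and constructions\<close>

text \<open>Only the additive group and the scalar multiplication of a module record matter; where such a
  record is built below, its ring fields \<open>mult\<close> and \<open>one\<close> are filled with the dummy zero.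
  Homomorphisms are constrained only on the carrier.\<close>

definition mod_hom :: "('r, 'n) ring_scheme \<Rightarrow> ('r, 'a) module \<Rightarrow> ('r, 'b) module \<Rightarrow> ('a \<Rightarrow> 'b) set"
  where "mod_hom R M N =
    {f \<in> carrier M \<rightarrow> carrier N.
      (\<forall>x \<in> carrier M. \<forall>y \<in> carrier M. f (x \<oplus>\<^bsub>M\<^esub> y) = f x \<oplus>\<^bsub>N\<^esub> f y) \<and>
      (\<forall>r \<in> carrier R. \<forall>x \<in> carrier M. f (r \<odot>\<^bsub>M\<^esub> x) = r \<odot>\<^bsub>N\<^esub> f x)}"

definition direct_sum_module :: "('r, 'a) module \<Rightarrow> ('r, 'b) module \<Rightarrow> ('r, 'a \<times> 'b) module"
  where "direct_sum_module M N =
    \<lparr>carrier = carrier M \<times> carrier N,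
     mult = (\<lambda>_ _. (\<zero>\<^bsub>M\<^esub>, \<zero>\<^bsub>N\<^esub>)),
     one = (\<zero>\<^bsub>M\<^esub>, \<zero>\<^bsub>N\<^esub>),
     zero = (\<zero>\<^bsub>M\<^esub>, \<zero>\<^bsub>N\<^esub>),
     add = (\<lambda>(x, y) (x', y'). (x \<oplus>\<^bsub>M\<^esub> x', y \<oplus>\<^bsub>N\<^esub> y')),
     smult = (\<lambda>r (x, y). (r \<odot>\<^bsub>M\<^esub> x, r \<odot>\<^bsub>N\<^esub> y))\<rparr>"

text \<open>On a coset \<open>K +> x\<close> of a submodule \<open>K\<close>, the union defining \<open>smult\<close> collapses to
  \<open>K +> r \<odot> x\<close>.\<close>

definition quotient_module :: "('r, 'a) module \<Rightarrow> 'a set \<Rightarrow> ('r, 'a set) module"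
  where "quotient_module M K =
    \<lparr>carrier = a_rcosets\<^bsub>M\<^esub> K,
     mult = (\<lambda>_ _. K),
     one = K,
     zero = K,
     add = set_add M,
     smult = (\<lambda>r X. \<Union>x\<in>X. K +>\<^bsub>M\<^esub> (r \<odot>\<^bsub>M\<^esub> x))\<rparr>"

text \<open>The elements of \<open>Hom\<^sub>R(M, N)\<close> are normalised to be \<open>extensional\<close>, so that homomorphisms
  agreeing on \<open>carrier M\<close> are equal.\<close>

definition Hom_module :: "('r, 'n) ring_scheme \<Rightarrow> ('r, 'a) module \<Rightarrow> ('r, 'b) module \<Rightarrow> ('r, 'a \<Rightarrow> 'b) module"
  where "Hom_module R M N =
    \<lparr>carrier = mod_hom R M N \<inter> extensional (carrier M),
     mult = (\<lambda>_ _. \<lambda>x\<in>carrier M. \<zero>\<^bsub>N\<^esub>),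
     one = (\<lambda>x\<in>carrier M. \<zero>\<^bsub>N\<^esub>),
     zero = (\<lambda>x\<in>carrier M. \<zero>\<^bsub>N\<^esub>),
     add = (\<lambda>f g. \<lambda>x\<in>carrier M. f x \<oplus>\<^bsub>N\<^esub> g x),
     smult = (\<lambda>r f. \<lambda>x\<in>carrier M. r \<odot>\<^bsub>N\<^esub> f x)\<rparr>"

definition Hom_map :: "('r, 'a) module \<Rightarrow> ('b \<Rightarrow> 'c) \<Rightarrow> ('a \<Rightarrow> 'b) \<Rightarrow> 'a \<Rightarrow> 'c"
  where "Hom_map M g h = compose (carrier M) g h"

definition kernel_module :: "('r, 'a) module \<Rightarrow> ('r, 'b) module \<Rightarrow> ('a \<Rightarrow> 'b) \<Rightarrow> ('r, 'a) module"
  where "kernel_module M N f = M\<lparr>carrier := a_kernel M N f\<rparr>"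

definition cokernel_module :: "('r, 'a) module \<Rightarrow> ('r, 'b) module \<Rightarrow> ('a \<Rightarrow> 'b) \<Rightarrow> ('r, 'b set) module"
  where "cokernel_module M N f = quotient_module N (f ` carrier M)"


section \<open>Uniform notions relative to a multiplicative subset\<close>

definition mult_subset :: "('r, 'n) ring_scheme \<Rightarrow> 'r set \<Rightarrow> bool"
  where "mult_subset R S \<longleftrightarrow> submonoid S R \<and> \<zero>\<^bsub>R\<^esub> \<notin> S"

definition uS_torsion :: "'r set \<Rightarrow> ('r, 'a) module \<Rightarrow> bool"
  where "uS_torsion S U \<longleftrightarrow> (\<exists>s\<in>S. \<forall>x\<in>carrier U. s \<odot>\<^bsub>U\<^esub> x = \<zero>\<^bsub>U\<^esub>)"

definition uS_epi ::
    "('r, 'n) ring_scheme \<Rightarrow> 'r set \<Rightarrow> ('r, 'a) module \<Rightarrow> ('r, 'b) module \<Rightarrow> ('a \<Rightarrow> 'b) \<Rightarrow> bool"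
  where "uS_epi R S M N f \<longleftrightarrow> f \<in> mod_hom R M N \<and> uS_torsion S (cokernel_module M N f)"

definition uS_exact ::
    "('r, 'n) ring_scheme \<Rightarrow> 'r set \<Rightarrow> ('r, 'a) module \<Rightarrow> ('r, 'b) module \<Rightarrow> ('r, 'c) module \<Rightarrow>
      ('a \<Rightarrow> 'b) \<Rightarrow> ('b \<Rightarrow> 'c) \<Rightarrow> bool"
  where "uS_exact R S A B C f g \<longleftrightarrow>
    f \<in> mod_hom R A B \<and> g \<in> mod_hom R B C \<and>
    (\<exists>s\<in>S. (\<forall>x\<in>a_kernel B C g. s \<odot>\<^bsub>B\<^esub> x \<in> f ` carrier A) \<and>
            (\<forall>x\<in>f ` carrier A. s \<odot>\<^bsub>B\<^esub> x \<in> a_kernel B C g))"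

text \<open>The two outer zero modules of \<open>0 \<rightarrow> A \<rightarrow> B \<rightarrow> C \<rightarrow> 0\<close> are represented by the zero submodules
  of \<open>A\<close> and of \<open>C\<close>.\<close>

definition uS_short_exact ::
    "('r, 'n) ring_scheme \<Rightarrow> 'r set \<Rightarrow> ('r, 'a) module \<Rightarrow> ('r, 'b) module \<Rightarrow> ('r, 'c) module \<Rightarrow>
      ('a \<Rightarrow> 'b) \<Rightarrow> ('b \<Rightarrow> 'c) \<Rightarrow> bool"
  where "uS_short_exact R S A B C f g \<longleftrightarrow>
    uS_exact R S (A\<lparr>carrier := {\<zero>\<^bsub>A\<^esub>}\<rparr>) A B (\<lambda>_. \<zero>\<^bsub>A\<^esub>) f \<and>
    uS_exact R S A B C f g \<and>
    uS_exact R S B C (C\<lparr>carrier := {\<zero>\<^bsub>C\<^esub>}\<rparr>) g (\<lambda>_. \<zero>\<^bsub>C\<^esub>)"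

definition uS_split ::
    "('r, 'n) ring_scheme \<Rightarrow> 'r set \<Rightarrow> ('r, 'a) module \<Rightarrow> ('r, 'b) module \<Rightarrow> ('r, 'c) module \<Rightarrow>
      ('a \<Rightarrow> 'b) \<Rightarrow> ('b \<Rightarrow> 'c) \<Rightarrow> bool"
  where "uS_split R S A B C f g \<longleftrightarrow>
    uS_short_exact R S A B C f g \<and>
    (\<exists>s\<in>S. \<exists>f'\<in>mod_hom R B A. \<forall>x\<in>carrier A. f' (f x) = s \<odot>\<^bsub>A\<^esub> x)"

definition uS_epi_splits ::
    "('r, 'n) ring_scheme \<Rightarrow> 'r set \<Rightarrow> ('r, 'a) module \<Rightarrow> ('r, 'b) module \<Rightarrow> ('a \<Rightarrow> 'b) \<Rightarrow> bool"
  where "uS_epi_splits R S A B f \<longleftrightarrow> uS_split R S (kernel_module A B f) A B (\<lambda>x. x) f"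

definition uS_pseudo_projective :: "('r, 'n) ring_scheme \<Rightarrow> 'r set \<Rightarrow> ('r, 'a) module \<Rightarrow> bool"
  where "uS_pseudo_projective R S P \<longleftrightarrow>
    (\<forall>K. submodule K R P \<longrightarrow>
      (\<exists>s\<in>S. \<forall>f. uS_epi R S P (quotient_module P K) f \<longrightarrow>
        (\<exists>g\<in>mod_hom R P P. \<forall>x\<in>carrier P.
          s \<odot>\<^bsub>quotient_module P K\<^esub> f x = K +>\<^bsub>P\<^esub> g x)))"

text \<open>HOL cannot quantify over types inside a definition, so the element type of the test modules
  \<open>L\<close> is a parameter; a theorem with a free type variable \<open>'l\<close> covers test modules of every type.\<close>

definition uS_projective_rel ::
    "'l itself \<Rightarrow> ('r, 'n) ring_scheme \<Rightarrow> 'r set \<Rightarrow> ('r, 'a) module \<Rightarrow> ('r, 'b) module \<Rightarrow> bool"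
  where "uS_projective_rel TYPE('l) R S M N \<longleftrightarrow>
    (\<forall>(L :: ('r, 'l) module) g. module R L \<longrightarrow> uS_epi R S N L g \<longrightarrow>
      uS_epi R S (Hom_module R M N) (Hom_module R M L) (Hom_map M g))"

end

theory Submission
  imports Defs
begin

text \<open>
  Relative projectivity. Let \<open>g : B \<rightarrow> L\<close> be a \<open>u\<close>-\<open>S\<close>-epimorphism, say \<open>t L \<subseteq> g(B)\<close>, and let
  \<open>P = A \<oplus> B\<close>. Up to isomorphism, the module \<open>P / (0 \<oplus> Ker g)\<close> is the image of \<open>q : P \<rightarrow> A \<oplus> L\<close>,
  \<open>q (a, b) = (a, g b)\<close>. For any homomorphism \<open>h : A \<rightarrow> L\<close>, the map \<open>u (a, b) = (a, t h(a) + g b)\<close>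
  has the same image, because \<open>t h(a)\<close> lies in \<open>g(B)\<close>; so \<open>u\<close> is an epimorphism from \<open>P\<close> onto this
  quotient. Pseudo-projectivity yields \<open>s \<in> S\<close>, depending only on \<open>Ker g\<close>, and an endomorphism
  \<open>G\<close> of \<open>P\<close> with \<open>q G = s u\<close>. Restricting \<open>G\<close> to \<open>A\<close> and projecting to \<open>B\<close> gives
  \<open>h' : A \<rightarrow> B\<close> with \<open>g h' = (s t) h\<close>. Since \<open>s t\<close> does not depend on \<open>h\<close>, it kills the cokernel of
  \<open>Hom(A, g)\<close>. This is carried by the lemmas \<open>uS_pseudo_projective_lift\<close>, which replaces the
  cosets in the definition of pseudo-projectivity by the map \<open>q\<close>, and \<open>uS_projective_rel_summands\<close>.

  Splitting. Applied to the identity of \<open>B\<close>, projectivity of \<open>B\<close> relative to \<open>A\<close> turns a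
  \<open>u\<close>-\<open>S\<close>-epimorphism \<open>f : A \<rightarrow> B\<close> into a map \<open>h : B \<rightarrow> A\<close> with \<open>f h = s\<close>; then
  \<open>x \<mapsto> s x - h (f x)\<close> maps \<open>A\<close> to \<open>Ker f\<close> and is multiplication by \<open>s\<close> on \<open>Ker f\<close>
  (lemma \<open>uS_epi_splits_if_projective_rel\<close>).
\<close>

section \<open>Homomorphisms, kernels and images\<close>

lemma mod_homI:
  assumes "\<And>x. x \<in> carrier M \<Longrightarrow> f x \<in> carrier N"
    and "\<And>x y. x \<in> carrier M \<Longrightarrow> y \<in> carrier M \<Longrightarrow> f (x \<oplus>\<^bsub>M\<^esub> y) = f x \<oplus>\<^bsub>N\<^esub> f y"
    and "\<And>r x. r \<in> carrier R \<Longrightarrow> x \<in> carrier M \<Longrightarrow> f (r \<odot>\<^bsub>M\<^esub> x) = r \<odot>\<^bsub>N\<^esub> f x"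
  shows "f \<in> mod_hom R M N"
  using assms by (auto simp: mod_hom_def)

lemma mod_homD:
  assumes "f \<in> mod_hom R M N"
  shows mod_hom_closed: "x \<in> carrier M \<Longrightarrow> f x \<in> carrier N"
    and mod_hom_add: "x \<in> carrier M \<Longrightarrow> y \<in> carrier M \<Longrightarrow> f (x \<oplus>\<^bsub>M\<^esub> y) = f x \<oplus>\<^bsub>N\<^esub> f y"
    and mod_hom_smult: "r \<in> carrier R \<Longrightarrow> x \<in> carrier M \<Longrightarrow> f (r \<odot>\<^bsub>M\<^esub> x) = r \<odot>\<^bsub>N\<^esub> f x"
  using assms by (auto simp: mod_hom_def)

lemma mod_hom_id: "(\<lambda>x. x) \<in> mod_hom R M M"
  by (intro mod_homI) simp_all

lemma mod_hom_comp:
  assumes "f \<in> mod_hom R M N" "g \<in> mod_hom R N L"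
  shows "(\<lambda>x. g (f x)) \<in> mod_hom R M L"
  by (intro mod_homI) (simp_all add: mod_homD[OF assms(1)] mod_homD[OF assms(2)])

lemma mod_hom_abelian_group_hom:
  assumes "module R M" "module R N" "f \<in> mod_hom R M N"
  shows "abelian_group_hom M N f"
proof -
  interpret M: module R M by fact
  interpret N: module R N by fact
  show ?thesis
    using assms(3) M.abelian_group_axioms N.abelian_group_axioms M.a_group N.a_group
    by (intro abelian_group_homI group_hom.intro group_hom_axioms.intro)
       (auto simp: hom_def mod_hom_def)
qed

lemma submodule_a_kernel:
  assumes "module R M" "module R N" "f \<in> mod_hom R M N"
  shows "submodule (a_kernel M N f) R M"
proof -
  interpret M: module R M by fact
  interpret N: module R N by fact
  interpret f: abelian_group_hom M N f by (rule mod_hom_abelian_group_hom) fact+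
  show ?thesis
    by (rule M.submoduleI) (auto simp: a_kernel_def' mod_homD[OF assms(3)])
qed

lemma submodule_image:
  assumes "module R M" "module R N" "f \<in> mod_hom R M N"
  shows "submodule (f ` carrier M) R N"
proof -
  interpret M: module R M by fact
  interpret N: module R N by fact
  interpret f: abelian_group_hom M N f by (rule mod_hom_abelian_group_hom) fact+
  show ?thesis
  proof (rule N.submoduleI)
    show "\<zero>\<^bsub>N\<^esub> \<in> f ` carrier M"
      by (metis M.zero_closed f.hom_zero imageI)
    show "\<ominus>\<^bsub>N\<^esub> y \<in> f ` carrier M" if "y \<in> f ` carrier M" for y
      using that by (metis (no_types, lifting) M.a_inv_closed f.hom_a_inv imageE imageI)
    show "y \<oplus>\<^bsub>N\<^esub> z \<in> f ` carrier M" if "y \<in> f ` carrier M" "z \<in> f ` carrier M" for y z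
      using that by (metis (no_types, lifting) M.a_closed f.hom_add imageE imageI)
    show "r \<odot>\<^bsub>N\<^esub> y \<in> f ` carrier M" if "r \<in> carrier R" "y \<in> f ` carrier M" for r y
      using that mod_hom_smult[OF assms(3)]
      by (metis (no_types, lifting) M.smult_closed imageE imageI)
  qed auto
qed


section \<open>Quotients and cokernels\<close>

context
  fixes R :: "('r, 'n) ring_scheme" and M :: "('r, 'a) module" and K
  assumes M: "module R M" and K: "submodule K R M"
begin

interpretation module R M by (rule M)

lemma submodule_abelian_subgroup: "abelian_subgroup K M"
  using K submodule.axioms(1) abelian_group_axioms abelian_subgroupI3 additive_subgroup_def by blast

interpretation K: abelian_subgroup K M by (rule submodule_abelian_subgroup)

lemma carrier_quotient_module: "carrier (quotient_module M K) = (\<lambda>x. K +>\<^bsub>M\<^esub> x) ` carrier M"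
  by (auto simp: quotient_module_def A_RCOSETS_def' )

lemma zero_quotient_module: "\<zero>\<^bsub>quotient_module M K\<^esub> = K"
  by (simp add: quotient_module_def)

lemma add_quotient_module:
  assumes "x \<in> carrier M" "y \<in> carrier M"
  shows "(K +>\<^bsub>M\<^esub> x) \<oplus>\<^bsub>quotient_module M K\<^esub> (K +>\<^bsub>M\<^esub> y) = K +>\<^bsub>M\<^esub> (x \<oplus>\<^bsub>M\<^esub> y)"
  using K.a_rcos_sum[OF assms] by (simp add: quotient_module_def)

lemma smult_quotient_module:
  assumes "r \<in> carrier R" "x \<in> carrier M"
  shows "r \<odot>\<^bsub>quotient_module M K\<^esub> (K +>\<^bsub>M\<^esub> x) = K +>\<^bsub>M\<^esub> (r \<odot>\<^bsub>M\<^esub> x)"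
proof -
  have "K +>\<^bsub>M\<^esub> (r \<odot>\<^bsub>M\<^esub> y) = K +>\<^bsub>M\<^esub> (r \<odot>\<^bsub>M\<^esub> x)" if y: "y \<in> K +>\<^bsub>M\<^esub> x" for y
  proof -
    obtain k where k: "k \<in> K" "y = k \<oplus>\<^bsub>M\<^esub> x"
      using y by (auto simp: a_r_coset_def')
    have "r \<odot>\<^bsub>M\<^esub> y = r \<odot>\<^bsub>M\<^esub> k \<oplus>\<^bsub>M\<^esub> r \<odot>\<^bsub>M\<^esub> x"
      using k assms by (simp add: smult_r_distr)
    moreover have "r \<odot>\<^bsub>M\<^esub> k \<in> K"
      using submoduleE(4)[OF K] k assms by blast
    ultimately have "r \<odot>\<^bsub>M\<^esub> y \<in> K +>\<^bsub>M\<^esub> (r \<odot>\<^bsub>M\<^esub> x)"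
      by (auto simp: a_r_coset_def')
    then show ?thesis
      using K.a_repr_independence' assms by blast
  qed
  then have "(\<Union>y\<in>K +>\<^bsub>M\<^esub> x. K +>\<^bsub>M\<^esub> (r \<odot>\<^bsub>M\<^esub> y)) = (\<Union>y\<in>K +>\<^bsub>M\<^esub> x. K +>\<^bsub>M\<^esub> (r \<odot>\<^bsub>M\<^esub> x))"
    by (rule SUP_cong[OF refl])
  also have "\<dots> = K +>\<^bsub>M\<^esub> (r \<odot>\<^bsub>M\<^esub> x)"
    using K.a_rcos_self[OF assms(2)] by blast
  finally show ?thesis
    by (simp add: quotient_module_def)
qed

lemma module_quotient_module: "module R (quotient_module M K)"
proof -
  note quot = carrier_quotient_module add_quotient_module smult_quotient_module
  have zero: "\<zero>\<^bsub>quotient_module M K\<^esub> = K +>\<^bsub>M\<^esub> \<zero>\<^bsub>M\<^esub>"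
    by (simp add: zero_quotient_module K.a_subset)
  have comm: "X \<oplus>\<^bsub>quotient_module M K\<^esub> Y = Y \<oplus>\<^bsub>quotient_module M K\<^esub> X"
    if "X \<in> carrier (quotient_module M K)" "Y \<in> carrier (quotient_module M K)" for X Y
    using that by (auto simp only: quot M.a_comm)
  have neg: "\<exists>Y\<in>carrier (quotient_module M K). Y \<oplus>\<^bsub>quotient_module M K\<^esub> X = \<zero>\<^bsub>quotient_module M K\<^esub>"
    if X: "X \<in> carrier (quotient_module M K)" for X
  proof -
    obtain x where x: "x \<in> carrier M" "X = K +>\<^bsub>M\<^esub> x"
      using X by (auto simp: quot)
    then have "(K +>\<^bsub>M\<^esub> (\<ominus>\<^bsub>M\<^esub> x)) \<oplus>\<^bsub>quotient_module M K\<^esub> X = \<zero>\<^bsub>quotient_module M K\<^esub>"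
      by (simp add: quot zero l_neg)
    with x show ?thesis
      by (auto simp: quot)
  qed
  show ?thesis
    by (intro moduleI abelian_groupI neg comm R.is_cring)
       (auto simp: quot zero M.a_assoc smult_l_distr smult_r_distr smult_assoc1)
qed

end

text \<open>The first isomorphism theorem for \<open>q\<close>, in elementwise form: cosets of the kernel may be
  compared by comparing the values of \<open>q\<close>.\<close>

lemma a_kernel_coset_eq_iff:
  assumes "module R M" "module R N" "q \<in> mod_hom R M N"
    and "x \<in> carrier M" "y \<in> carrier M"
  shows "a_kernel M N q +>\<^bsub>M\<^esub> x = a_kernel M N q +>\<^bsub>M\<^esub> y \<longleftrightarrow> q x = q y"
proof -
  interpret M: module R M by fact
  interpret N: module R N by fact
  interpret q: abelian_group_hom M N q by (rule mod_hom_abelian_group_hom) fact+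
  interpret K: abelian_subgroup "a_kernel M N q" M by (rule q.abelian_subgroup_a_kernel)
  have "a_kernel M N q +>\<^bsub>M\<^esub> x = a_kernel M N q +>\<^bsub>M\<^esub> y \<longleftrightarrow> y \<in> a_kernel M N q +>\<^bsub>M\<^esub> x"
    using K.a_repr_independence'[OF _ assms(4)] K.a_rcos_self[OF assms(5)] by blast
  also have "\<dots> \<longleftrightarrow> y \<oplus>\<^bsub>M\<^esub> \<ominus>\<^bsub>M\<^esub> x \<in> a_kernel M N q"
    using assms(4,5) by (rule K.a_rcos_module)
  also have "\<dots> \<longleftrightarrow> q y \<oplus>\<^bsub>N\<^esub> \<ominus>\<^bsub>N\<^esub> q x = \<zero>\<^bsub>N\<^esub>"
    using assms(4,5) q.hom_add[of y "\<ominus>\<^bsub>M\<^esub> x"] q.hom_a_inv[of x] M.a_closed[of y "\<ominus>\<^bsub>M\<^esub> x"]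
      M.a_inv_closed[of x]
    unfolding a_kernel_def' by simp
  also have "\<dots> \<longleftrightarrow> q x = q y"
  proof
    assume "q y \<oplus>\<^bsub>N\<^esub> \<ominus>\<^bsub>N\<^esub> q x = \<zero>\<^bsub>N\<^esub>"
    then have "\<ominus>\<^bsub>N\<^esub> (\<ominus>\<^bsub>N\<^esub> q x) = q y"
      using assms(4,5) by (intro N.minus_equality) simp_all
    then show "q x = q y"
      using assms(4,5) by simp
  qed (use assms(4,5) in \<open>simp add: N.r_neg\<close>)
  finally show ?thesis .
qed

text \<open>In the cokernel, \<open>s\<close> kills the coset of \<open>y\<close> exactly when \<open>s y\<close> lies in the image, so
  being a \<open>u\<close>-\<open>S\<close>-epimorphism becomes a condition on elements, free of cosets.\<close>

lemma uS_epi_iff: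
  assumes "module R M" "module R N" "S \<subseteq> carrier R"
  shows "uS_epi R S M N f \<longleftrightarrow>
    f \<in> mod_hom R M N \<and> (\<exists>s\<in>S. \<forall>y\<in>carrier N. s \<odot>\<^bsub>N\<^esub> y \<in> f ` carrier M)"
proof -
  interpret N: module R N by fact
  have "uS_torsion S (cokernel_module M N f) \<longleftrightarrow> (\<exists>s\<in>S. \<forall>y\<in>carrier N. s \<odot>\<^bsub>N\<^esub> y \<in> f ` carrier M)"
    if f: "f \<in> mod_hom R M N"
  proof -
    define I where "I = f ` carrier M"
    have I: "submodule I R N"
      unfolding I_def by (rule submodule_image[OF assms(1,2) f])
    have "s \<odot>\<^bsub>quotient_module N I\<^esub> (I +>\<^bsub>N\<^esub> y) = I \<longleftrightarrow> s \<odot>\<^bsub>N\<^esub> y \<in> I"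
      if "s \<in> S" "y \<in> carrier N" for s y
    proof -
      have s: "s \<in> carrier R"
        using that(1) assms(3) by blast
      have sub: "subgroup I (add_monoid N)"
        using I by (rule submodule.axioms(1))
      show ?thesis
        unfolding smult_quotient_module[OF assms(2) I s that(2)]
        using N.a_coset_join1[OF _ N.smult_closed[OF s that(2)] sub]
          N.a_coset_join2[OF N.smult_closed[OF s that(2)] sub] by blast
    qed
    then show ?thesis
      unfolding uS_torsion_def cokernel_module_def zero_quotient_module[OF assms(2) I] I_def[symmetric]
        carrier_quotient_module[OF assms(2) I]
      by simp
  qed
  then show ?thesis
    unfolding uS_epi_def by blast
qed


section \<open>Direct sums and modules of homomorphisms\<close>

lemma direct_sum_module_simps [simp]:
  "carrier (direct_sum_module M N) = carrier M \<times> carrier N"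
  "\<zero>\<^bsub>direct_sum_module M N\<^esub> = (\<zero>\<^bsub>M\<^esub>, \<zero>\<^bsub>N\<^esub>)"
  "p \<oplus>\<^bsub>direct_sum_module M N\<^esub> p' = (fst p \<oplus>\<^bsub>M\<^esub> fst p', snd p \<oplus>\<^bsub>N\<^esub> snd p')"
  "r \<odot>\<^bsub>direct_sum_module M N\<^esub> p = (r \<odot>\<^bsub>M\<^esub> fst p, r \<odot>\<^bsub>N\<^esub> snd p)"
  by (auto simp: direct_sum_module_def split: prod.splits)

lemma module_direct_sum_module:
  assumes "module R M" "module R N"
  shows "module R (direct_sum_module M N)"
proof -
  interpret M: module R M by fact
  interpret N: module R N by fact
  have neg: "\<exists>p'\<in>carrier (direct_sum_module M N).
      p' \<oplus>\<^bsub>direct_sum_module M N\<^esub> p = \<zero>\<^bsub>direct_sum_module M N\<^esub>"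
    if "p \<in> carrier (direct_sum_module M N)" for p
    using that by (intro bexI[of _ "(\<ominus>\<^bsub>M\<^esub> fst p, \<ominus>\<^bsub>N\<^esub> snd p)"]) (auto simp: M.l_neg N.l_neg)
  show ?thesis
    by (intro moduleI abelian_groupI neg M.R.is_cring)
       (auto simp: M.a_ac N.a_ac M.smult_l_distr N.smult_l_distr
          M.smult_r_distr N.smult_r_distr M.smult_assoc1 N.smult_assoc1)
qed

lemma mod_hom_Pair:
  assumes "f \<in> mod_hom R P M" "g \<in> mod_hom R P N"
  shows "(\<lambda>p. (f p, g p)) \<in> mod_hom R P (direct_sum_module M N)"
  by (intro mod_homI) (simp_all add: mod_homD[OF assms(1)] mod_homD[OF assms(2)])

lemma mod_hom_zero_map:
  assumes "module R N"
  shows "(\<lambda>x. \<zero>\<^bsub>N\<^esub>) \<in> mod_hom R M N"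
proof -
  interpret N: module R N by fact
  show ?thesis
    by (intro mod_homI) simp_all
qed

lemma mod_hom_add_map:
  assumes "module R N" "f \<in> mod_hom R M N" "g \<in> mod_hom R M N"
  shows "(\<lambda>x. f x \<oplus>\<^bsub>N\<^esub> g x) \<in> mod_hom R M N"
proof -
  interpret N: module R N by fact
  show ?thesis
    by (intro mod_homI)
       (simp_all add: mod_homD[OF assms(2)] mod_homD[OF assms(3)] N.a_ac N.smult_r_distr)
qed

text \<open>Commutativity of \<open>R\<close> enters here: a scalar multiple of a homomorphism is again linear.\<close>

lemma mod_hom_smult_map:
  assumes "module R N" "f \<in> mod_hom R M N" "r \<in> carrier R"
  shows "(\<lambda>x. r \<odot>\<^bsub>N\<^esub> f x) \<in> mod_hom R M N"
proof -
  interpret N: module R N by fact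
  have "r \<odot>\<^bsub>N\<^esub> (r' \<odot>\<^bsub>N\<^esub> f x) = r' \<odot>\<^bsub>N\<^esub> (r \<odot>\<^bsub>N\<^esub> f x)"
    if "r' \<in> carrier R" "x \<in> carrier M" for r' x
    using that assms(3) N.R.m_comm mod_hom_closed[OF assms(2)]
    by (simp flip: N.smult_assoc1)
  then show ?thesis
    by (intro mod_homI) (simp_all add: mod_homD[OF assms(2)] assms(3) N.smult_r_distr)
qed

lemma mod_hom_uminus_map:
  assumes "module R N" "f \<in> mod_hom R M N"
  shows "(\<lambda>x. \<ominus>\<^bsub>N\<^esub> f x) \<in> mod_hom R M N"
proof -
  interpret N: module R N by fact
  show ?thesis
    by (intro mod_homI)
       (simp_all add: mod_homD[OF assms(2)] N.minus_add N.smult_r_minus)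
qed

text \<open>Homomorphisms are constrained only on the carrier, so restricting one to the carrier gives
  the element of the homomorphism module that represents it.\<close>

lemma restrict_mod_hom:
  assumes "module R M" "f \<in> mod_hom R M N"
  shows "restrict f (carrier M) \<in> mod_hom R M N"
proof -
  interpret M: module R M by fact
  show ?thesis
    by (intro mod_homI) (simp_all add: mod_homD[OF assms(2)])
qed

lemma Hom_module_simps [simp]:
  "carrier (Hom_module R M N) = mod_hom R M N \<inter> extensional (carrier M)"
  "\<zero>\<^bsub>Hom_module R M N\<^esub> = (\<lambda>x\<in>carrier M. \<zero>\<^bsub>N\<^esub>)"
  "f \<oplus>\<^bsub>Hom_module R M N\<^esub> g = (\<lambda>x\<in>carrier M. f x \<oplus>\<^bsub>N\<^esub> g x)"
  "r \<odot>\<^bsub>Hom_module R M N\<^esub> f = (\<lambda>x\<in>carrier M. r \<odot>\<^bsub>N\<^esub> f x)"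
  by (auto simp: Hom_module_def)

lemma module_Hom_module:
  assumes "module R M" "module R N"
  shows "module R (Hom_module R M N)"
proof -
  interpret M: module R M by fact
  interpret N: module R N by fact
  note restr = restrict_mod_hom[OF assms(1)]
  have neg: "\<exists>g\<in>carrier (Hom_module R M N). g \<oplus>\<^bsub>Hom_module R M N\<^esub> f = \<zero>\<^bsub>Hom_module R M N\<^esub>"
    if "f \<in> carrier (Hom_module R M N)" for f
    using that mod_hom_uminus_map[OF assms(2), of f M]
    by (intro bexI[of _ "\<lambda>x\<in>carrier M. \<ominus>\<^bsub>N\<^esub> f x"])
       (auto intro!: restr restrict_ext simp: N.l_neg mod_hom_closed)
  show ?thesis
    by (intro moduleI abelian_groupI neg M.R.is_cring)
       (auto intro!: restr restrict_ext extensionalityI[of _ "carrier M"] mod_hom_zero_map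
          mod_hom_add_map mod_hom_smult_map assms
          simp: N.a_ac N.smult_l_distr N.smult_r_distr N.smult_assoc1 mod_hom_closed)
qed

lemma Hom_map_mod_hom:
  assumes "module R M" "module R N" "g \<in> mod_hom R N L"
  shows "Hom_map M g \<in> mod_hom R (Hom_module R M N) (Hom_module R M L)"
proof -
  interpret M: module R M by fact
  interpret N: module R N by fact
  show ?thesis
  proof (rule mod_homI)
    show "Hom_map M g h \<in> carrier (Hom_module R M L)" if "h \<in> carrier (Hom_module R M N)" for h
      using that restrict_mod_hom[OF assms(1) mod_hom_comp[OF _ assms(3)]]
      by (auto simp: Hom_map_def compose_def)
  qed (auto simp: Hom_map_def compose_def fun_eq_iff mod_hom_closed mod_homD[OF assms(3)])
qed

text \<open>The same criterion for the map induced on homomorphism modules, freed from the normalisation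
  to extensional functions: every \<open>h\<close> may be lifted along \<open>g\<close> after multiplication by an \<open>s\<close> that
  does not depend on \<open>h\<close>.\<close>

lemma uS_epi_Hom_map_iff:
  assumes "module R M" "module R N" "module R L" "S \<subseteq> carrier R" "g \<in> mod_hom R N L"
  shows "uS_epi R S (Hom_module R M N) (Hom_module R M L) (Hom_map M g) \<longleftrightarrow>
    (\<exists>s\<in>S. \<forall>h\<in>mod_hom R M L. \<exists>h'\<in>mod_hom R M N. \<forall>x\<in>carrier M. g (h' x) = s \<odot>\<^bsub>L\<^esub> h x)"
    (is "?epi \<longleftrightarrow> (\<exists>s\<in>S. ?lifts s)")
proof -
  interpret M: module R M by fact
  have "(\<forall>h\<in>carrier (Hom_module R M L). s \<odot>\<^bsub>Hom_module R M L\<^esub> h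
      \<in> Hom_map M g ` carrier (Hom_module R M N)) \<longleftrightarrow> ?lifts s" (is "?image \<longleftrightarrow> _")
    for s
  proof
    assume image: ?image
    show "?lifts s"
    proof
      fix h assume h: "h \<in> mod_hom R M L"
      have "restrict h (carrier M) \<in> carrier (Hom_module R M L)"
        using restrict_mod_hom[OF assms(1) h] by simp
      with image obtain h' where h': "h' \<in> mod_hom R M N"
        "s \<odot>\<^bsub>Hom_module R M L\<^esub> restrict h (carrier M) = Hom_map M g h'"
        by fastforce
      have "g (h' x) = s \<odot>\<^bsub>L\<^esub> h x" if "x \<in> carrier M" for x
        using fun_cong[OF h'(2), of x] that by (simp add: Hom_map_def compose_def)
      with h'(1) show "\<exists>h'\<in>mod_hom R M N. \<forall>x\<in>carrier M. g (h' x) = s \<odot>\<^bsub>L\<^esub> h x"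
        by blast
    qed
  next
    assume lifts: "?lifts s"
    show ?image
    proof
      fix h assume "h \<in> carrier (Hom_module R M L)"
      with lifts obtain h' where h': "h' \<in> mod_hom R M N"
        "\<And>x. x \<in> carrier M \<Longrightarrow> g (h' x) = s \<odot>\<^bsub>L\<^esub> h x"
        by auto
      have "s \<odot>\<^bsub>Hom_module R M L\<^esub> h = Hom_map M g (restrict h' (carrier M))"
        using h'(2) by (auto simp: Hom_map_def compose_def fun_eq_iff)
      moreover have "restrict h' (carrier M) \<in> carrier (Hom_module R M N)"
        using restrict_mod_hom[OF assms(1) h'(1)] by simp
      ultimately show "s \<odot>\<^bsub>Hom_module R M L\<^esub> h \<in> Hom_map M g ` carrier (Hom_module R M N)"
        by blast
    qed
  qed
  then show ?thesis
    using uS_epi_iff[OF module_Hom_module[OF assms(1,2)] module_Hom_module[OF assms(1,3)] assms(4)]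
      Hom_map_mod_hom[OF assms(1,2,5)] by simp
qed


section \<open>Pseudo-projectivity and relative projectivity\<close>

text \<open>Pseudo-projectivity applied to the kernel of \<open>q\<close>. The quotient of \<open>P\<close> by this kernel is the
  image of \<open>q\<close>, so a homomorphism \<open>u\<close> whose values lie in the image of \<open>q\<close> and cover it up to \<open>t\<close>
  amounts to a \<open>u\<close>-\<open>S\<close>-epimorphism onto the quotient. The order of quantifiers matters: \<open>s\<close> is found
  before \<open>u\<close> and \<open>t\<close>.\<close>

lemma uS_pseudo_projective_lift:
  assumes "module R P" "module R Q" "S \<subseteq> carrier R"
    and "uS_pseudo_projective R S P" and "q \<in> mod_hom R P Q"
  obtains s where "s \<in> S"
    and "\<And>u t. \<lbrakk>u \<in> mod_hom R P Q; u ` carrier P \<subseteq> q ` carrier P; t \<in> S;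
            \<And>x. x \<in> carrier P \<Longrightarrow> t \<odot>\<^bsub>Q\<^esub> q x \<in> u ` carrier P\<rbrakk>
          \<Longrightarrow> \<exists>g\<in>mod_hom R P P. \<forall>x\<in>carrier P. q (g x) = s \<odot>\<^bsub>Q\<^esub> u x"
proof -
  interpret P: module R P by fact
  interpret Q: module R Q by fact
  note q = mod_homD[OF assms(5)]
  define K where "K = a_kernel P Q q"
  have K: "submodule K R P"
    unfolding K_def by (rule submodule_a_kernel) fact+
  note quot = carrier_quotient_module[OF assms(1) K] add_quotient_module[OF assms(1) K]
    smult_quotient_module[OF assms(1) K]
  have coset_eq: "K +>\<^bsub>P\<^esub> x = K +>\<^bsub>P\<^esub> y \<longleftrightarrow> q x = q y" if "x \<in> carrier P" "y \<in> carrier P" for x y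
    unfolding K_def by (rule a_kernel_coset_eq_iff) fact+
  from assms(4) K obtain s where s: "s \<in> S"
    and lift: "\<And>f. uS_epi R S P (quotient_module P K) f \<Longrightarrow>
      \<exists>g\<in>mod_hom R P P. \<forall>x\<in>carrier P. s \<odot>\<^bsub>quotient_module P K\<^esub> f x = K +>\<^bsub>P\<^esub> g x"
    unfolding uS_pseudo_projective_def by blast
  show thesis
  proof (rule that[OF s])
    fix u t
    assume u: "u \<in> mod_hom R P Q" and sub: "u ` carrier P \<subseteq> q ` carrier P"
      and t: "t \<in> S" and tq: "\<And>x. x \<in> carrier P \<Longrightarrow> t \<odot>\<^bsub>Q\<^esub> q x \<in> u ` carrier P"
    have "\<forall>x\<in>carrier P. \<exists>y\<in>carrier P. q y = u x"
      using sub by (metis image_iff image_subset_iff)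
    then obtain c where c: "\<And>x. x \<in> carrier P \<Longrightarrow> c x \<in> carrier P"
      "\<And>x. x \<in> carrier P \<Longrightarrow> q (c x) = u x"
      by metis
    \<comment> \<open>The choice of \<open>c\<close> need not be linear, but its cosets modulo the kernel of \<open>q\<close> are.\<close>
    define F where "F x = K +>\<^bsub>P\<^esub> c x" for x
    have "F \<in> mod_hom R P (quotient_module P K)"
      by (intro mod_homI) (simp_all add: F_def quot c coset_eq q mod_homD[OF u])
    moreover have "t \<odot>\<^bsub>quotient_module P K\<^esub> Y \<in> F ` carrier P"
      if Y: "Y \<in> carrier (quotient_module P K)" for Y
    proof -
      obtain y where y: "y \<in> carrier P" "Y = K +>\<^bsub>P\<^esub> y"
        using Y by (auto simp: quot)
      obtain x where x: "x \<in> carrier P" "t \<odot>\<^bsub>Q\<^esub> q y = u x"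
        using tq[OF y(1)] by auto
      have "t \<in> carrier R"
        using t assms(3) by blast
      then have "t \<odot>\<^bsub>quotient_module P K\<^esub> Y = F x"
        using x y by (simp add: F_def quot coset_eq c q)
      with x(1) show ?thesis
        by blast
    qed
    ultimately have "uS_epi R S P (quotient_module P K) F"
      using uS_epi_iff[OF assms(1) module_quotient_module[OF assms(1) K] assms(3)] t by blast
    from lift[OF this] obtain g where g: "g \<in> mod_hom R P P"
      "\<And>x. x \<in> carrier P \<Longrightarrow> s \<odot>\<^bsub>quotient_module P K\<^esub> F x = K +>\<^bsub>P\<^esub> g x"
      by blast
    have "q (g x) = s \<odot>\<^bsub>Q\<^esub> u x" if x: "x \<in> carrier P" for x
    proof -
      have sR: "s \<in> carrier R"
        using s assms(3) by blast
      have "K +>\<^bsub>P\<^esub> (s \<odot>\<^bsub>P\<^esub> c x) = K +>\<^bsub>P\<^esub> g x"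
        using g(2)[OF x] by (simp add: F_def quot c x sR)
      then have "q (s \<odot>\<^bsub>P\<^esub> c x) = q (g x)"
        using coset_eq c x sR mod_hom_closed[OF g(1)] by simp
      then show ?thesis
        using c x sR by (simp add: q)
    qed
    with g(1) show "\<exists>g\<in>mod_hom R P P. \<forall>x\<in>carrier P. q (g x) = s \<odot>\<^bsub>Q\<^esub> u x"
      by blast
  qed
qed

text \<open>The summands are given by injections and projections, not as the factors of a pair type, so
  that exchanging the roles of the two summands needs no isomorphism between \<open>A \<oplus> B\<close> and \<open>B \<oplus> A\<close>.
  To lift \<open>h : M \<rightarrow> L\<close> along \<open>g : N \<rightarrow> L\<close>, the map \<open>q\<close> below applies \<open>g\<close> to the summand \<open>N\<close>, and
  \<open>u\<close> is \<open>q\<close> with \<open>t h\<close> added in the second coordinate; a lift of \<open>s u\<close> along \<open>q\<close> contains a lift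
  of \<open>(s t) h\<close> along \<open>g\<close>.\<close>

lemma uS_projective_rel_summands:
  fixes M :: "('r, 'a) module" and N :: "('r, 'b) module" and P :: "('r, 'p) module"
  assumes "module R M" "module R N" "module R P" "mult_subset R S"
    and "uS_pseudo_projective R S P"
    and iM: "iM \<in> mod_hom R M P" and iN: "iN \<in> mod_hom R N P"
    and pM: "pM \<in> mod_hom R P M" and pN: "pN \<in> mod_hom R P N"
    and pM_iM: "\<And>x. x \<in> carrier M \<Longrightarrow> pM (iM x) = x"
    and pN_iM: "\<And>x. x \<in> carrier M \<Longrightarrow> pN (iM x) = \<zero>\<^bsub>N\<^esub>"
    and pM_iN: "\<And>y. y \<in> carrier N \<Longrightarrow> pM (iN y) = \<zero>\<^bsub>M\<^esub>"
    and pN_iN: "\<And>y. y \<in> carrier N \<Longrightarrow> pN (iN y) = y"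
  shows "uS_projective_rel TYPE('l) R S M N"
  unfolding uS_projective_rel_def
proof (intro allI impI)
  fix L :: "('r, 'l) module" and g
  assume L: "module R L" and epi: "uS_epi R S N L g"
  interpret M: module R M by fact
  interpret N: module R N by fact
  interpret P: module R P by fact
  interpret L: module R L by fact
  interpret S: submonoid S R
    using assms(4) by (simp add: mult_subset_def)
  have g: "g \<in> mod_hom R N L"
    using epi by (simp add: uS_epi_def)
  obtain t where t: "t \<in> S" and tg: "\<And>z. z \<in> carrier L \<Longrightarrow> t \<odot>\<^bsub>L\<^esub> z \<in> g ` carrier N"
    using epi uS_epi_iff[OF assms(2) L S.subset] by blast
  interpret g: abelian_group_hom N L g by (rule mod_hom_abelian_group_hom) fact+
  have tR: "t \<in> carrier R"
    using t S.subset by blast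
  let ?Q = "direct_sum_module M L"
  define q where "q p = (pM p, g (pN p))" for p
  note homs = mod_homD[OF iM] mod_homD[OF iN] mod_homD[OF pM] mod_homD[OF pN] mod_homD[OF g]
  have q: "q \<in> mod_hom R P ?Q"
    unfolding q_def by (intro mod_hom_Pair pM mod_hom_comp[OF pN g])
  obtain s where s: "s \<in> S"
    and lift: "\<And>u t. \<lbrakk>u \<in> mod_hom R P ?Q; u ` carrier P \<subseteq> q ` carrier P; t \<in> S;
        \<And>x. x \<in> carrier P \<Longrightarrow> t \<odot>\<^bsub>?Q\<^esub> q x \<in> u ` carrier P\<rbrakk>
      \<Longrightarrow> \<exists>G\<in>mod_hom R P P. \<forall>x\<in>carrier P. q (G x) = s \<odot>\<^bsub>?Q\<^esub> u x"
    by (rule uS_pseudo_projective_lift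
        [OF assms(3) module_direct_sum_module[OF assms(1) L] S.subset assms(5) q]) blast
  have sR: "s \<in> carrier R"
    using s S.subset by blast
  have "\<exists>h'\<in>mod_hom R M N. \<forall>x\<in>carrier M. g (h' x) = (s \<otimes>\<^bsub>R\<^esub> t) \<odot>\<^bsub>L\<^esub> h x"
    if h: "h \<in> mod_hom R M L" for h
  proof -
    note hom_h = mod_homD[OF h]
    define u where "u p = (pM p, t \<odot>\<^bsub>L\<^esub> h (pM p) \<oplus>\<^bsub>L\<^esub> g (pN p))" for p
    have u: "u \<in> mod_hom R P ?Q"
      unfolding u_def
      by (intro mod_hom_Pair pM mod_hom_add_map mod_hom_smult_map mod_hom_comp[OF pM h]
          mod_hom_comp[OF pN g] L tR)
    \<comment> \<open>Translating \<open>p\<close> by \<open>b\<close> or \<open>- b\<close> in the summand \<open>N\<close> exchanges the values of \<open>q\<close> and \<open>u\<close>,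
      so their images agree.\<close>
    have shear: "\<exists>b\<in>carrier N. g b = t \<odot>\<^bsub>L\<^esub> h (pM p)" if "p \<in> carrier P" for p
      using tg[of "h (pM p)"] that by (auto simp: homs hom_h)
    have "u p \<in> q ` carrier P" if p: "p \<in> carrier P" for p
    proof -
      obtain b where b: "b \<in> carrier N" "g b = t \<odot>\<^bsub>L\<^esub> h (pM p)"
        using shear[OF p] by blast
      have "u p = q (iN b \<oplus>\<^bsub>P\<^esub> p)"
        using b p by (simp add: u_def q_def homs pM_iN pN_iN)
      then show ?thesis
        using b p by (simp add: homs)
    qed
    moreover have "q p \<in> u ` carrier P" if p: "p \<in> carrier P" for p
    proof -
      obtain b where b: "b \<in> carrier N" "g b = t \<odot>\<^bsub>L\<^esub> h (pM p)"
        using shear[OF p] by blast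
      have "q p = u (iN (\<ominus>\<^bsub>N\<^esub> b) \<oplus>\<^bsub>P\<^esub> p)"
        using b p by (simp add: u_def q_def homs pM_iN pN_iN hom_h L.r_neg flip: b(2) L.a_assoc)
      then show ?thesis
        using b p by (simp add: homs)
    qed
    moreover have "\<one>\<^bsub>R\<^esub> \<odot>\<^bsub>?Q\<^esub> q p = q p" if "p \<in> carrier P" for p
      using that by (simp add: q_def homs)
    ultimately have "\<exists>G\<in>mod_hom R P P. \<forall>p\<in>carrier P. q (G p) = s \<odot>\<^bsub>?Q\<^esub> u p"
      by (intro lift[OF u image_subsetI S.one_closed]) (simp_all only:)
    then obtain G where G: "G \<in> mod_hom R P P"
      "\<And>p. p \<in> carrier P \<Longrightarrow> q (G p) = s \<odot>\<^bsub>?Q\<^esub> u p"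
      by blast
    have lifts_h: "g (pN (G (iM x))) = (s \<otimes>\<^bsub>R\<^esub> t) \<odot>\<^bsub>L\<^esub> h x" if "x \<in> carrier M" for x
      using G(2)[of "iM x"] that sR tR
      by (simp add: q_def u_def homs pM_iM pN_iM hom_h L.smult_assoc1)
    show ?thesis
      by (rule bexI[OF _ mod_hom_comp[OF mod_hom_comp[OF iM G(1)] pN]]) (rule ballI, rule lifts_h)
  qed
  moreover have "s \<otimes>\<^bsub>R\<^esub> t \<in> S"
    using s t by blast
  ultimately show "uS_epi R S (Hom_module R M N) (Hom_module R M L) (Hom_map M g)"
    using uS_epi_Hom_map_iff[OF assms(1,2) L S.subset g] by blast
qed


section \<open>Splitting\<close>

text \<open>Lifting the identity of \<open>B\<close> along \<open>f\<close> up to \<open>s\<close> gives \<open>h\<close> with \<open>f h = s\<close>. The definition of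
  splitting asks instead for a retraction onto the kernel up to \<open>s\<close>, for which \<open>s x - h (f x)\<close>
  serves. The test module is \<open>B\<close> itself, whence the type at which projectivity is used.\<close>

lemma uS_epi_splits_if_projective_rel:
  fixes A :: "('r, 'a) module" and B :: "('r, 'b) module"
  assumes "module R A" "module R B" "mult_subset R S"
    and rel: "uS_projective_rel TYPE('b) R S B A" and epi: "uS_epi R S A B f"
  shows "uS_epi_splits R S A B f"
proof -
  interpret A: module R A by fact
  interpret B: module R B by fact
  interpret S: submonoid S R
    using assms(3) by (simp add: mult_subset_def)
  have f: "f \<in> mod_hom R A B"
    using epi by (simp add: uS_epi_def)
  interpret f: abelian_group_hom A B f by (rule mod_hom_abelian_group_hom) fact+
  obtain t where t: "t \<in> S" "\<And>y. y \<in> carrier B \<Longrightarrow> t \<odot>\<^bsub>B\<^esub> y \<in> f ` carrier A"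
    using epi uS_epi_iff[OF assms(1,2) S.subset] by blast
  have "uS_epi R S (Hom_module R B A) (Hom_module R B B) (Hom_map B f)"
    using rel epi assms(2) unfolding uS_projective_rel_def by blast
  then obtain s where s: "s \<in> S" and lift: "\<forall>k\<in>mod_hom R B B. \<exists>h\<in>mod_hom R B A.
      \<forall>y\<in>carrier B. f (h y) = s \<odot>\<^bsub>B\<^esub> k y"
    unfolding uS_epi_Hom_map_iff[OF assms(2,1,2) S.subset f] by (rule bexE)
  obtain h where h: "h \<in> mod_hom R B A"
    and fh: "\<And>y. y \<in> carrier B \<Longrightarrow> f (h y) = s \<odot>\<^bsub>B\<^esub> y"
    using bspec[OF lift mod_hom_id] by blast
  have sR: "s \<in> carrier R"
    using s S.subset by blast
  interpret h: abelian_group_hom B A h by (rule mod_hom_abelian_group_hom) fact+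
  define r where "r x = s \<odot>\<^bsub>A\<^esub> x \<oplus>\<^bsub>A\<^esub> \<ominus>\<^bsub>A\<^esub> h (f x)" for x
  have "r \<in> mod_hom R A A"
    unfolding r_def
    by (intro mod_hom_id mod_hom_add_map mod_hom_smult_map mod_hom_uminus_map mod_hom_comp[OF f h] assms sR)
  moreover have "f (r x) = \<zero>\<^bsub>B\<^esub>" if "x \<in> carrier A" for x
    using that sR by (simp add: r_def fh mod_hom_smult[OF f] B.r_neg)
  ultimately have r: "r \<in> mod_hom R A (kernel_module A B f)"
    by (auto simp: mod_hom_def kernel_module_def a_kernel_def')
  have r_kernel: "r x = s \<odot>\<^bsub>A\<^esub> x" if "x \<in> a_kernel A B f" for x
    using that sR by (simp add: r_def a_kernel_def')
  have "uS_exact R S (kernel_module A B f\<lparr>carrier := {\<zero>\<^bsub>A\<^esub>}\<rparr>) (kernel_module A B f) A (\<lambda>_. \<zero>\<^bsub>A\<^esub>) (\<lambda>x. x)"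
    using s unfolding uS_exact_def
    by (auto simp: mod_hom_def kernel_module_def a_kernel_def')
  moreover have "uS_exact R S (kernel_module A B f) A B (\<lambda>x. x) f"
    using f s unfolding uS_exact_def
    by (auto simp: mod_hom_def kernel_module_def a_kernel_def')
  moreover have "uS_exact R S A B (B\<lparr>carrier := {\<zero>\<^bsub>B\<^esub>}\<rparr>) f (\<lambda>_. \<zero>\<^bsub>B\<^esub>)"
    using f t S.subset unfolding uS_exact_def
    by (auto simp: mod_hom_def a_kernel_def' intro!: bexI[OF _ t(1)])
  ultimately have "uS_short_exact R S (kernel_module A B f) A B (\<lambda>x. x) f"
    by (simp add: uS_short_exact_def kernel_module_def)
  then show ?thesis
    unfolding uS_epi_splits_def uS_split_def
    using s r r_kernel by (auto simp: kernel_module_def)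
qed

theorem proposition2p9:
  fixes R :: "('r, 'n) ring_scheme"
    and S :: "'r set"
    and A :: "('r, 'a) module"
    and B :: "('r, 'b) module"
  assumes "cring R" and "\<one>\<^bsub>R\<^esub> \<noteq> \<zero>\<^bsub>R\<^esub>"
    and "mult_subset R S"
    and "module R A" and "module R B"
    and "uS_pseudo_projective R S (direct_sum_module A B)"
  shows "(uS_projective_rel TYPE('l) R S A B \<and> uS_projective_rel TYPE('l) R S B A) \<and>
         (\<forall>f. uS_epi R S A B f \<longrightarrow> uS_epi_splits R S A B f)"
proof -
  interpret A: module R A by fact
  interpret B: module R B by fact
  let ?P = "direct_sum_module A B"
  have P: "module R ?P"
    by (rule module_direct_sum_module) fact+
  have iA: "(\<lambda>a. (a, \<zero>\<^bsub>B\<^esub>)) \<in> mod_hom R A ?P" and iB: "(\<lambda>b. (\<zero>\<^bsub>A\<^esub>, b)) \<in> mod_hom R B ?P"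
    and pA: "fst \<in> mod_hom R ?P A" and pB: "snd \<in> mod_hom R ?P B"
    by (auto intro!: mod_homI)
  have AB: "uS_projective_rel TYPE('l) R S A B"
    by (rule uS_projective_rel_summands[OF assms(4,5) P assms(3,6) iA iB pA pB]) simp_all
  have BA: "uS_projective_rel TYPE('l) R S B A"
    by (rule uS_projective_rel_summands[OF assms(5,4) P assms(3,6) iB iA pB pA]) simp_all
  \<comment> \<open>Splitting tests projectivity on \<open>B\<close>, whose element type need not be \<open>'l\<close>.\<close>
  have "uS_projective_rel TYPE('b) R S B A"
    by (rule uS_projective_rel_summands[OF assms(5,4) P assms(3,6) iB iA pB pA]) simp_all
  then show ?thesis
    using AB BA uS_epi_splits_if_projective_rel[OF assms(4,5,3)] by blast
qed

end
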